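(* Let $H$ be a monoid. Consider the following conditions: (i) for every $a\in H$ there exist $n\geq 1$ and $s_1,\dots,s_n\in\mathcal{S}(H)$ such that $a=s_1s_2\cdots s_n$; (ii) for every $a\in H$ there exist $n\geq 1$ and $s_1,\dots,s_n\in\mathcal{S}(H)$ such that $s_i\mid s_{i+1}$ for $i=1,\dots,n-1$, and $a=s_1s_2\cdots s_n$; (iii) for every $a\in H$ there exist $n\geq 1$ and $s_1,\dots,s_n\in\mathcal{S}(H)$ such that $s_i,s_j$ are relatively prime for $i\neq j$, and $a=s_1s_2^2s_3^3\cdots s_n^n$; (iv) for every $a\in H$ there exist $n\geq 0$ and $s_0,s_1,\dots,s_n\in\mathcal{S}(H)$ such that $a=s_0s_1^2s_2^{2^2}\cdots s_n^{2^n}$; (v) for every $a\in H$ there exist $b\in H$ and $c\in\mathcal{S}(H)$ such that $a=bc$ and $a\mid c^n$ for some $n\geq 1$; (vi) for every $a\in H$ there exist $b\in H$ and $c\in\mathcal{S}(H)$ such that $a=b^2c$. Then: a) The following implications hold: ($H$ satisfies ACCP) $\Rightarrow$ ($H$ is atomic) $\Rightarrow$ (i); ($H$ satisfies ACCP) $\Rightarrow$ (iv); (iii) $\Rightarrow$ (i); (iv) $\Rightarrow$ (i); (ii) $\Rightarrow$ (iii); (ii) $\Rightarrow$ (v); (iv) $\Rightarrow$ (vi). b) If $H$ is a decomposition monoid, then (ii) $\Leftrightarrow$ (iii) and (iii) $\Rightarrow$ (iv). c) If $H$ is a GCD-monoid, then (ii) $\Leftrightarrow$ (iii) $\Leftrightarrow$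 (iv).
   Context: Monoid means commutative cancellative monoid (written multiplicatively). $H^{\times}$ denotes the group of invertible elements of $H$. An element $a\in H$ is square-free if it cannot be written as $a=b^2c$ with $b,c\in H$ and $b\notin H^{\times}$; $\mathcal{S}(H)$ is the set of square-free elements (it contains $H^{\times}$). Two elements are relatively prime if they have no common non-invertible divisor. An atom is a non-invertible element that is not a product of two non-invertible elements; $H$ is atomic if every non-invertible element is a finite product of atoms. $H$ satisfies ACCP if every ascending chain of principal ideals $a_1H\subset a_2H\subset\cdots$ stabilizes. $H$ is a decomposition monoid if for all $a,b,c\in H$ with $a\mid bc$ there exist $a_1,a_2\in H$ with $a=a_1a_2$, $a_1\mid b$ and $a_2\mid c$. $H$ is a GCD-monoid if any two elements have a greatest common divisor. *)

theory Defs
  imports "HOL-Algebra.Algebra"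
begin

text \<open>
  Throughout, a monoid is a commutative cancellative monoid, i.e. a model of
  the locale \<^locale>\<open>comm_monoid_cancel\<close>; its group of invertible elements is
  \<^const>\<open>Units\<close>, and the GCD-monoids are the models of \<^locale>\<open>gcd_condition_monoid\<close>.
  Finite products indexed by natural numbers are written with \<^const>\<open>finprod\<close>.
\<close>

definition squarefree_elements :: "('a, 'b) monoid_scheme \<Rightarrow> 'a set" where
  "squarefree_elements H =
     {a \<in> carrier H. \<not> (\<exists>b\<in>carrier H. \<exists>c\<in>carrier H.
        b \<notin> Units H \<and> a = b [^]\<^bsub>H\<^esub> (2::nat) \<otimes>\<^bsub>H\<^esub> c)}"

definition rel_prime :: "('a, 'b) monoid_scheme \<Rightarrow> 'a \<Rightarrow> 'a \<Rightarrow> bool" where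
  "rel_prime H a b \<longleftrightarrow>
     \<not> (\<exists>d\<in>carrier H. d \<notin> Units H \<and> d divides\<^bsub>H\<^esub> a \<and> d divides\<^bsub>H\<^esub> b)"

definition atoms :: "('a, 'b) monoid_scheme \<Rightarrow> 'a set" where
  "atoms H =
     {a \<in> carrier H. a \<notin> Units H \<and>
        \<not> (\<exists>b\<in>carrier H. \<exists>c\<in>carrier H. b \<notin> Units H \<and> c \<notin> Units H \<and> a = b \<otimes>\<^bsub>H\<^esub> c)}"

lemma (in comm_monoid_cancel) atoms_iff_irreducible:
  "a \<in> atoms G \<longleftrightarrow> a \<in> carrier G \<and> irreducible G a"
proof -
  have "properfactor G b (b \<otimes> c) \<longleftrightarrow> c \<notin> Units G"
    if "b \<in> carrier G" "c \<in> carrier G" for b c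
    using that by (metis Units_r_inv_ex associatedI2 associated_sym m_assoc r_one
        associated_def properfactorE2 properfactorI3 properfactor_def dividesI)
  then show ?thesis
    unfolding atoms_def irreducible_def
    by (auto simp: properfactor_def elim!: dividesE) blast
qed

definition atomic :: "('a, 'b) monoid_scheme \<Rightarrow> bool" where
  "atomic H \<longleftrightarrow>
     (\<forall>a\<in>carrier H - Units H. \<exists>n::nat. \<exists>u\<in>{1..n} \<rightarrow> atoms H.
        a = (\<Otimes>\<^bsub>H\<^esub>i\<in>{1..n}. u i))"

definition ACCP :: "('a, 'b) monoid_scheme \<Rightarrow> bool" where
  "ACCP H \<longleftrightarrow>
     (\<forall>a :: nat \<Rightarrow> 'a. range a \<subseteq> carrier H \<longrightarrow>
        (\<forall>i. a i <#\<^bsub>H\<^esub> carrier H \<subseteq> a (Suc i) <#\<^bsub>H\<^esub> carrier H) \<longrightarrow>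
        (\<exists>N. \<forall>i\<ge>N. a i <#\<^bsub>H\<^esub> carrier H = a N <#\<^bsub>H\<^esub> carrier H))"

locale decomposition_monoid = comm_monoid_cancel +
  assumes decomposition:
    "\<lbrakk>a \<in> carrier G; b \<in> carrier G; c \<in> carrier G; a divides (b \<otimes> c)\<rbrakk>
      \<Longrightarrow> \<exists>a1\<in>carrier G. \<exists>a2\<in>carrier G. a = a1 \<otimes> a2 \<and> a1 divides b \<and> a2 divides c"

definition cond_i :: "('a, 'b) monoid_scheme \<Rightarrow> bool" where
  "cond_i H \<longleftrightarrow>
     (\<forall>a\<in>carrier H. \<exists>n::nat. n \<ge> 1 \<and> (\<exists>s\<in>{1..n} \<rightarrow> squarefree_elements H.
        a = (\<Otimes>\<^bsub>H\<^esub>i\<in>{1..n}. s i)))"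

definition cond_ii :: "('a, 'b) monoid_scheme \<Rightarrow> bool" where
  "cond_ii H \<longleftrightarrow>
     (\<forall>a\<in>carrier H. \<exists>n::nat. n \<ge> 1 \<and> (\<exists>s\<in>{1..n} \<rightarrow> squarefree_elements H.
        (\<forall>i\<in>{1..<n}. s i divides\<^bsub>H\<^esub> s (i + 1)) \<and>
        a = (\<Otimes>\<^bsub>H\<^esub>i\<in>{1..n}. s i)))"

definition cond_iii :: "('a, 'b) monoid_scheme \<Rightarrow> bool" where
  "cond_iii H \<longleftrightarrow>
     (\<forall>a\<in>carrier H. \<exists>n::nat. n \<ge> 1 \<and> (\<exists>s\<in>{1..n} \<rightarrow> squarefree_elements H.
        (\<forall>i\<in>{1..n}. \<forall>j\<in>{1..n}. i \<noteq> j \<longrightarrow> rel_prime H (s i) (s j)) \<and>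
        a = (\<Otimes>\<^bsub>H\<^esub>i\<in>{1..n}. s i [^]\<^bsub>H\<^esub> i)))"

definition cond_iv :: "('a, 'b) monoid_scheme \<Rightarrow> bool" where
  "cond_iv H \<longleftrightarrow>
     (\<forall>a\<in>carrier H. \<exists>n::nat. \<exists>s\<in>{0..n} \<rightarrow> squarefree_elements H.
        a = (\<Otimes>\<^bsub>H\<^esub>i\<in>{0..n}. s i [^]\<^bsub>H\<^esub> ((2::nat) ^ i)))"

definition cond_v :: "('a, 'b) monoid_scheme \<Rightarrow> bool" where
  "cond_v H \<longleftrightarrow>
     (\<forall>a\<in>carrier H. \<exists>b\<in>carrier H. \<exists>c\<in>squarefree_elements H.
        a = b \<otimes>\<^bsub>H\<^esub> c \<and> (\<exists>n::nat. n \<ge> 1 \<and> a divides\<^bsub>H\<^esub> (c [^]\<^bsub>H\<^esub> n)))"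

definition cond_vi :: "('a, 'b) monoid_scheme \<Rightarrow> bool" where
  "cond_vi H \<longleftrightarrow>
     (\<forall>a\<in>carrier H. \<exists>b\<in>carrier H. \<exists>c\<in>squarefree_elements H.
        a = b [^]\<^bsub>H\<^esub> (2::nat) \<otimes>\<^bsub>H\<^esub> c)"

end

theory Submission
  imports Defs
begin

text \<open>
  The implications rest on three observations. First, if \<open>s\<^sub>1, \<dots>, s\<^sub>n\<close> is a divisor chain and
  \<open>s\<^sub>i = t\<^sub>1 \<cdots> t\<^sub>i\<close>, then \<open>s\<^sub>1 \<cdots> s\<^sub>n = t\<^sub>1\<^sup>n t\<^sub>2\<^sup>n\<^sup>-\<^sup>1 \<cdots> t\<^sub>n\<close>, and the \<open>t\<^sub>i\<close> are pairwise relatively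
  prime because \<open>t\<^sub>i t\<^sub>j\<close> divides the square-free element \<open>s\<^sub>n\<close>. In a decomposition monoid this can be
  reversed, since there products of pairwise relatively prime square-free elements are square-free;
  splitting exponents by parity then also yields (iv). Second, \<open>a = b\<^sup>2c\<close> with \<open>c\<close> square-free turns
  a representation (iv) of \<open>b\<close> into one of \<open>a\<close>; under ACCP such a \<open>b\<close> exists and the
  recursion terminates. Third, in a GCD-monoid (i) already implies (ii): to insert a square-free \<open>c\<close>
  into a divisor chain with top element \<open>t\<close>, replace \<open>t\<close> by \<open>lcm(c, t)\<close> and go on inserting
  \<open>gcd(c, t)\<close> below it.
\<close>

section \<open>Finite products\<close>

context comm_monoid
begin

lemma finprod_Suc_atLeastAtMost:
  assumes "f \<in> {1..Suc n} \<rightarrow> carrier G"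
  shows "(\<Otimes>i\<in>{1..Suc n}. f i) = (\<Otimes>i\<in>{1..n}. f i) \<otimes> f (Suc n)"
proof -
  have "{1..Suc n} = insert (Suc n) {1..n}" by auto
  moreover have "f \<in> {1..n} \<rightarrow> carrier G" "f (Suc n) \<in> carrier G"
    using assms by auto
  ultimately show ?thesis by (simp add: m_comm)
qed

lemma finprod_append:
  assumes "s \<in> {1..n::nat} \<rightarrow> carrier G" "t \<in> {1..m::nat} \<rightarrow> carrier G"
  shows "(\<Otimes>i\<in>{1..n}. s i) \<otimes> (\<Otimes>i\<in>{1..m}. t i) =
         (\<Otimes>i\<in>{1..n + m}. if i \<le> n then s i else t (i - n))"
  using assms(2)
proof (induction m)
  case 0
  have "(\<Otimes>i\<in>{1..n}. if i \<le> n then s i else t (i - n)) = (\<Otimes>i\<in>{1..n}. s i)"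
    using assms(1) by (intro finprod_cong') auto
  then show ?case using assms(1) by simp
next
  case (Suc m)
  let ?f = "\<lambda>i. if i \<le> n then s i else t (i - n)"
  have f: "?f \<in> {1..Suc (n + m)} \<rightarrow> carrier G"
  proof
    fix i assume "i \<in> {1..Suc (n + m)}"
    then show "?f i \<in> carrier G"
      using funcset_mem[OF assms(1), of i] funcset_mem[OF Suc.prems, of "i - n"]
      by (auto simp: le_diff_conv)
  qed
  have t: "t \<in> {1..m} \<rightarrow> carrier G" "t (Suc m) \<in> carrier G"
    using Suc.prems by auto
  have "(\<Otimes>i\<in>{1..n}. s i) \<otimes> (\<Otimes>i\<in>{1..Suc m}. t i) =
        ((\<Otimes>i\<in>{1..n}. s i) \<otimes> (\<Otimes>i\<in>{1..m}. t i)) \<otimes> t (Suc m)"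
    using Suc.prems t assms(1) by (subst finprod_Suc_atLeastAtMost) (simp_all add: m_assoc)
  also have "\<dots> = (\<Otimes>i\<in>{1..n + m}. ?f i) \<otimes> ?f (Suc (n + m))"
    using Suc.IH[OF t(1)] by simp
  also have "\<dots> = (\<Otimes>i\<in>{1..Suc (n + m)}. ?f i)"
    using finprod_Suc_atLeastAtMost[OF f] by simp
  finally show ?case by simp
qed

lemma finprod_nat_pow:
  assumes "f \<in> A \<rightarrow> carrier G"
  shows "(\<Otimes>i\<in>A. f i [^] (k::nat)) = (\<Otimes>i\<in>A. f i) [^] k"
  using assms by (induction A rule: infinite_finite_induct) (auto simp: nat_pow_distrib Pi_iff)

lemma finprod_rev_atLeastAtMost:
  assumes "f \<in> {1..n::nat} \<rightarrow> carrier G"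
  shows "(\<Otimes>i\<in>{1..n}. f (n + 1 - i)) = (\<Otimes>i\<in>{1..n}. f i)"
proof -
  have inj: "inj_on (\<lambda>i. n + 1 - i) {1..n}"
    by (auto simp: inj_on_def)
  moreover have "(\<lambda>i. n + 1 - i) ` {1..n} = {1..n}"
    using inj by (intro endo_inj_surj) auto
  ultimately show ?thesis
    using finprod_reindex[of f "\<lambda>i. n + 1 - i" "{1..n}"] assms by simp
qed

text \<open>Interchange the order of multiplication: \<open>t j\<close> occurs in the rows
  \<open>i = j, ..., n\<close>, that is, \<open>n + 1 - j\<close> times.\<close>

lemma finprod_triangle:
  assumes "t \<in> {1..n::nat} \<rightarrow> carrier G"
  shows "(\<Otimes>i\<in>{1..n}. \<Otimes>j\<in>{1..i}. t j) = (\<Otimes>j\<in>{1..n}. t j [^] (n + 1 - j))"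
  using assms
proof (induction n)
  case 0
  then show ?case by simp
next
  case (Suc n)
  have t: "t \<in> {1..n} \<rightarrow> carrier G" "t (Suc n) \<in> carrier G"
    using Suc.prems by auto
  have "(\<Otimes>i\<in>{1..Suc n}. \<Otimes>j\<in>{1..i}. t j) =
        (\<Otimes>i\<in>{1..n}. \<Otimes>j\<in>{1..i}. t j) \<otimes> (\<Otimes>j\<in>{1..Suc n}. t j)"
    using Suc.prems by (intro finprod_Suc_atLeastAtMost) (auto intro!: finprod_closed)
  also have "\<dots> = (\<Otimes>j\<in>{1..n}. t j [^] (n + 1 - j)) \<otimes> ((\<Otimes>j\<in>{1..n}. t j) \<otimes> t (Suc n))"
    using Suc.IH[OF t(1)] finprod_Suc_atLeastAtMost[OF Suc.prems] by simp
  \<comment> \<open>The row \<open>i = Suc n\<close> supplies one more copy of every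
    \<open>t j\<close> with \<open>j \<le> n\<close>, which raises each exponent by one.\<close>
  also have "\<dots> = (\<Otimes>j\<in>{1..n}. t j [^] (n + 1 - j) \<otimes> t j) \<otimes> t (Suc n)"
    using t by (subst finprod_multf) (auto simp: m_assoc Pi_iff)
  also have "(\<Otimes>j\<in>{1..n}. t j [^] (n + 1 - j) \<otimes> t j) = (\<Otimes>j\<in>{1..n}. t j [^] (Suc n + 1 - j))"
    using t by (intro finprod_cong') (auto simp: Suc_diff_le Pi_iff)
  also have "\<dots> \<otimes> t (Suc n) = (\<Otimes>j\<in>{1..Suc n}. t j [^] (Suc n + 1 - j))"
    using Suc.prems by (subst finprod_Suc_atLeastAtMost) (auto simp: Pi_iff)
  finally show ?case .
qed

text \<open>Reversing the index turns the exponent \<open>n + 1 - j\<close> into \<open>i\<close>.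
  The identity serves both directions between (ii) and (iii).\<close>

lemma finprod_triangle_rev:
  assumes "s \<in> {1..n::nat} \<rightarrow> carrier G"
  shows "(\<Otimes>i\<in>{1..n}. \<Otimes>j\<in>{1..i}. s (n + 1 - j)) = (\<Otimes>i\<in>{1..n}. s i [^] i)"
proof -
  have "(\<Otimes>i\<in>{1..n}. \<Otimes>j\<in>{1..i}. s (n + 1 - j)) = (\<Otimes>j\<in>{1..n}. s (n + 1 - j) [^] (n + 1 - j))"
    by (intro finprod_triangle) (auto intro!: funcset_mem[OF assms])
  also have "\<dots> = (\<Otimes>i\<in>{1..n}. s i [^] i)"
    using assms by (intro finprod_rev_atLeastAtMost) (auto simp: Pi_iff)
  finally show ?thesis .
qed

text \<open>If the whole product is square-free, then so is the product of any two of its factors,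
  which makes these two relatively prime.\<close>

lemma mult_divides_finprod:
  assumes "t \<in> A \<rightarrow> carrier G" "finite A" "i \<in> A" "j \<in> A" "i \<noteq> j"
  shows "t i \<otimes> t j divides (\<Otimes>k\<in>A. t k)"
proof -
  have A: "A = insert i (insert j (A - {i, j}))"
    using assms by auto
  have t: "t \<in> A - {i, j} \<rightarrow> carrier G" "t i \<in> carrier G" "t j \<in> carrier G"
    using assms by auto
  have "(\<Otimes>k\<in>A. t k) = t i \<otimes> (t j \<otimes> (\<Otimes>k\<in>A - {i, j}. t k))"
    using assms t by (subst A, subst finprod_insert) (auto simp: finprod_insert)
  then show ?thesis
    using t by (intro dividesI[of "\<Otimes>k\<in>A - {i, j}. t k"]) (auto simp: m_assoc)
qed

lemma divides_finprod:
  assumes "t \<in> A \<rightarrow> carrier G" "finite A" "i \<in> A"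
  shows "t i divides (\<Otimes>k\<in>A. t k)"
proof -
  have A: "A = insert i (A - {i})"
    using assms by auto
  have "t \<in> A - {i} \<rightarrow> carrier G" "t i \<in> carrier G"
    using assms by auto
  then have "(\<Otimes>k\<in>A. t k) = t i \<otimes> (\<Otimes>k\<in>A - {i}. t k)" "(\<Otimes>k\<in>A - {i}. t k) \<in> carrier G"
    using assms finprod_insert[of "A - {i}" i t] A by auto
  then show ?thesis by auto
qed

end

text \<open>The empty product \<open>n = 0\<close> is allowed, so that \<open>\<one>\<close> belongs
  for every \<open>S\<close> and inductions over powers and products have their base case; the
  demand \<open>n \<ge> 1\<close> of (i) is restored in \<open>cond_i_iff\<close>.\<close>

definition finite_products :: "('a, 'b) monoid_scheme \<Rightarrow> 'a set \<Rightarrow> 'a set" where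
  "finite_products H S = {a. \<exists>n::nat. \<exists>s\<in>{1..n} \<rightarrow> S. a = (\<Otimes>\<^bsub>H\<^esub>i\<in>{1..n}. s i)}"

context comm_monoid
begin

lemma finite_products_incl:
  assumes "S \<subseteq> carrier G" "a \<in> S"
  shows "a \<in> finite_products G S"
  unfolding finite_products_def using assms
  by (auto intro!: exI[of _ 1] bexI[of _ "\<lambda>_. a"])

lemma finite_products_one: "\<one> \<in> finite_products G S"
  unfolding finite_products_def by (auto intro!: exI[of _ 0])

lemma finite_products_closed:
  assumes "S \<subseteq> carrier G"
  shows "finite_products G S \<subseteq> carrier G"
  unfolding finite_products_def using assms by (auto intro!: finprod_closed)

lemma finite_products_mult:
  assumes "S \<subseteq> carrier G" "a \<in> finite_products G S" "b \<in> finite_products G S"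
  shows "a \<otimes> b \<in> finite_products G S"
proof -
  from assms obtain n s m t where s: "s \<in> {1..n::nat} \<rightarrow> S" "a = (\<Otimes>i\<in>{1..n}. s i)"
    and t: "t \<in> {1..m::nat} \<rightarrow> S" "b = (\<Otimes>i\<in>{1..m}. t i)"
    unfolding finite_products_def by blast
  have "a \<otimes> b = (\<Otimes>i\<in>{1..n + m}. if i \<le> n then s i else t (i - n))"
    unfolding s t using s t assms(1) by (intro finprod_append) auto
  moreover have "(\<lambda>i. if i \<le> n then s i else t (i - n)) \<in> {1..n + m} \<rightarrow> S"
  proof
    fix i assume "i \<in> {1..n + m}"
    then show "(if i \<le> n then s i else t (i - n)) \<in> S"
      using funcset_mem[OF s(1), of i] funcset_mem[OF t(1), of "i - n"]
      by (auto simp: le_diff_conv)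
  qed
  ultimately show ?thesis unfolding finite_products_def by blast
qed

lemma finite_products_nat_pow:
  assumes "S \<subseteq> carrier G" "a \<in> finite_products G S"
  shows "a [^] (k::nat) \<in> finite_products G S"
  using assms by (induction k) (auto intro: finite_products_one finite_products_mult)

lemma finite_products_finprod:
  assumes "S \<subseteq> carrier G" "f \<in> A \<rightarrow> finite_products G S"
  shows "(\<Otimes>i\<in>A. f i) \<in> finite_products G S"
  using assms(2)
proof (induction A rule: infinite_finite_induct)
  case (insert x A)
  then have "f \<in> A \<rightarrow> carrier G" "f x \<in> carrier G"
    using finite_products_closed[OF assms(1)] by auto
  then show ?case
    using insert assms(1) by (auto intro: finite_products_mult)
qed (auto intro: finite_products_one)

end

section \<open>Square-free elements\<close>

context comm_monoid_cancel
begin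

text \<open>The cofactor in the definition is hidden in a divisibility, so that later arguments can
  use transitivity.\<close>

lemma squarefree_iff:
  "a \<in> squarefree_elements G \<longleftrightarrow>
     a \<in> carrier G \<and> (\<forall>b\<in>carrier G. b \<otimes> b divides a \<longrightarrow> b \<in> Units G)"
  unfolding squarefree_elements_def factor_def by (auto simp: numeral_2_eq_2)

lemma squarefree_carrier: "squarefree_elements G \<subseteq> carrier G"
  unfolding squarefree_elements_def by auto

lemma squarefree_divisor:
  assumes "a \<in> squarefree_elements G" "b \<in> carrier G" "b divides a"
  shows "b \<in> squarefree_elements G"
  using assms unfolding squarefree_iff by (meson divides_trans m_closed)

lemma Units_squarefree: "u \<in> Units G \<Longrightarrow> u \<in> squarefree_elements G"
  unfolding squarefree_iff by (meson Units_closed divides_unit m_closed unit_factor)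

lemma one_squarefree: "\<one> \<in> squarefree_elements G"
  by (simp add: Units_squarefree)

lemma atoms_squarefree: "atoms G \<subseteq> squarefree_elements G"
proof
  fix a assume a: "a \<in> atoms G"
  have "b \<in> Units G" if b: "b \<in> carrier G" "b \<otimes> b divides a" for b
  proof -
    \<comment> \<open>In \<open>a = b \<otimes> (b \<otimes> c)\<close> one of the two factors of
      the atom is invertible; if it is \<open>b \<otimes> c\<close>, then \<open>b\<close> is
      invertible as well.\<close>
    from b obtain c where c: "c \<in> carrier G" "a = b \<otimes> (b \<otimes> c)"
      by (auto simp: m_assoc elim: dividesE)
    then have "b \<in> Units G \<or> b \<otimes> c \<in> Units G"
      using a b unfolding atoms_def by blast
    then show ?thesis using b c unit_factor by blast
  qed
  then show "a \<in> squarefree_elements G"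
    using a unfolding squarefree_iff atoms_def by auto
qed

lemma unit_mult_divides:
  assumes "u \<in> Units G" "b \<in> carrier G"
  shows "u \<otimes> b divides b"
proof (rule dividesI)
  show "inv u \<in> carrier G" using assms by simp
  have "u \<otimes> b \<otimes> inv u = b \<otimes> (u \<otimes> inv u)"
    using assms by (simp only: m_ac Units_closed Units_inv_closed)
  then show "b = u \<otimes> b \<otimes> inv u" using assms by simp
qed

lemma rel_primeD:
  assumes "rel_prime G a b" "d \<in> carrier G" "d divides a" "d divides b"
  shows "d \<in> Units G"
  using assms unfolding rel_prime_def by blast

lemma rel_prime_sym: "rel_prime G a b \<Longrightarrow> rel_prime G b a"
  unfolding rel_prime_def by blast

text \<open>A common divisor \<open>d\<close> of \<open>a\<close> and \<open>b\<close> yields the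
  square divisor \<open>d \<otimes> d\<close> of \<open>a \<otimes> b\<close>.\<close>

lemma squarefree_mult_imp_rel_prime:
  assumes "a \<otimes> b \<in> squarefree_elements G" "a \<in> carrier G" "b \<in> carrier G"
  shows "rel_prime G a b"
  unfolding rel_prime_def
proof clarify
  fix d assume d: "d \<in> carrier G" "d \<notin> Units G" "d divides a" "d divides b"
  have "d \<otimes> d divides a \<otimes> d" using d assms by auto
  moreover have "a \<otimes> d divides a \<otimes> b" using d assms by auto
  ultimately have "d \<otimes> d divides a \<otimes> b"
    using d assms by (meson divides_trans m_closed)
  then show False using assms d unfolding squarefree_iff by blast
qed

section \<open>Implications in arbitrary monoids\<close>

lemma cond_i_iff: "cond_i G \<longleftrightarrow> carrier G \<subseteq> finite_products G (squarefree_elements G)"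
proof
  assume "cond_i G"
  then show "carrier G \<subseteq> finite_products G (squarefree_elements G)"
    unfolding cond_i_def finite_products_def by blast
next
  assume *: "carrier G \<subseteq> finite_products G (squarefree_elements G)"
  show "cond_i G"
    unfolding cond_i_def
  proof
    fix a assume "a \<in> carrier G"
    with * obtain n s where s: "s \<in> {1..n::nat} \<rightarrow> squarefree_elements G" "a = (\<Otimes>i\<in>{1..n}. s i)"
      unfolding finite_products_def by blast
    show "\<exists>n::nat\<ge>1. \<exists>s\<in>{1..n} \<rightarrow> squarefree_elements G. a = (\<Otimes>i\<in>{1..n}. s i)"
    proof (cases "n = 0")
      \<comment> \<open>The empty product equals \<open>\<one>\<close>, which is represented with
        \<open>n = 1\<close> by the single factor \<open>\<one>\<close>.\<close>
      case True
      with s have "(\<lambda>_. \<one>) \<in> {1..1::nat} \<rightarrow> squarefree_elements G" "a = (\<Otimes>i\<in>{1..1::nat}. \<one>)"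
        using one_squarefree by auto
      then show ?thesis by blast
    next
      case False
      with s show ?thesis by (intro exI[of _ n]) auto
    qed
  qed
qed

lemma atomic_iff: "atomic G \<longleftrightarrow> carrier G - Units G \<subseteq> finite_products G (atoms G)"
  unfolding atomic_def finite_products_def by blast

lemma atomic_imp_cond_i:
  assumes "atomic G"
  shows "cond_i G"
  unfolding cond_i_iff
proof
  fix a assume a: "a \<in> carrier G"
  show "a \<in> finite_products G (squarefree_elements G)"
  proof (cases "a \<in> Units G")
    case True
    then show ?thesis
      by (simp add: Units_squarefree finite_products_incl squarefree_carrier)
  next
    case False
    then have "a \<in> finite_products G (atoms G)"
      using a assms unfolding atomic_iff by blast
    then show ?thesis
      using atoms_squarefree unfolding finite_products_def by blast
  qed
qed

lemma cond_iii_imp_cond_i: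
  assumes "cond_iii G"
  shows "cond_i G"
  unfolding cond_i_iff
proof
  fix a assume "a \<in> carrier G"
  then obtain n s where s: "s \<in> {1..n::nat} \<rightarrow> squarefree_elements G"
      "a = (\<Otimes>i\<in>{1..n}. s i [^] i)"
    using assms unfolding cond_iii_def by blast
  then show "a \<in> finite_products G (squarefree_elements G)"
    by (simp only:) (intro finite_products_finprod finite_products_nat_pow finite_products_incl
        squarefree_carrier Pi_I, auto)
qed

lemma cond_iv_imp_cond_i:
  assumes "cond_iv G"
  shows "cond_i G"
  unfolding cond_i_iff
proof
  fix a assume "a \<in> carrier G"
  then obtain n s where s: "s \<in> {0..n::nat} \<rightarrow> squarefree_elements G"
      "a = (\<Otimes>i\<in>{0..n}. s i [^] ((2::nat) ^ i))"
    using assms unfolding cond_iv_def by blast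
  then show "a \<in> finite_products G (squarefree_elements G)"
    by (simp only:) (intro finite_products_finprod finite_products_nat_pow finite_products_incl
        squarefree_carrier Pi_I, auto)
qed

section \<open>Divisor chains and what follows from (ii)\<close>

lemma divides_chain_mono:
  assumes "\<forall>i\<in>{1..<n}. s i divides s (i + 1)" "s \<in> {1..n} \<rightarrow> carrier G"
    and "1 \<le> i" "i \<le> j" "j \<le> (n::nat)"
  shows "s i divides s j"
  using assms(4,5)
proof (induction j rule: dec_induct)
  case base
  then show ?case using assms by auto
next
  case (step k)
  then have "s i divides s k" "s k divides s (Suc k)" "s i \<in> carrier G"
    using assms by (auto simp: Pi_iff)
  then show ?case by (rule divides_trans)
qed

text \<open>Telescoping: \<open>t 1\<close> is \<open>s 1\<close>, and each later \<open>t i\<close>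
  is the quotient of \<open>s i\<close> by \<open>s (i - 1)\<close>.\<close>

lemma divides_chain_partial_products:
  assumes chain: "\<forall>i\<in>{1..<n}. s i divides s (i + 1)" and s: "s \<in> {1..n::nat} \<rightarrow> carrier G"
  obtains t where "t \<in> {1..n} \<rightarrow> carrier G" "\<And>i. i \<in> {1..n} \<Longrightarrow> s i = (\<Otimes>j\<in>{1..i}. t j)"
proof -
  have "\<forall>i\<in>{1..<n}. \<exists>c\<in>carrier G. s (i + 1) = s i \<otimes> c"
    using chain by (auto simp: factor_def)
  then obtain c where c: "\<And>i. i \<in> {1..<n} \<Longrightarrow> c i \<in> carrier G \<and> s (i + 1) = s i \<otimes> c i"
    by metis
  define t where "t i = (if i = 1 then s 1 else c (i - 1))" for i
  have t: "t \<in> {1..n} \<rightarrow> carrier G"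
  proof
    fix i assume "i \<in> {1..n}"
    then show "t i \<in> carrier G"
      using s c[of "i - 1"] by (cases "i = 1") (auto simp: t_def Pi_iff less_diff_conv2)
  qed
  have "s i = (\<Otimes>j\<in>{1..i}. t j)" if "1 \<le> i" "i \<le> n" for i
    using that
  proof (induction i rule: dec_induct)
    case base
    have "s 1 \<in> carrier G" using s that by auto
    then show ?case by (simp add: t_def)
  next
    case (step k)
    have "(\<Otimes>j\<in>{1..Suc k}. t j) = (\<Otimes>j\<in>{1..k}. t j) \<otimes> t (Suc k)"
      using t step by (intro finprod_Suc_atLeastAtMost) auto
    then show ?case
      using step c[of k] by (simp add: t_def)
  qed
  then show thesis using that[OF t] by auto
qed

lemma cond_ii_imp_cond_iii:
  assumes "cond_ii G"
  shows "cond_iii G"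
  unfolding cond_iii_def
proof
  fix a assume "a \<in> carrier G"
  then obtain n s where n: "n \<ge> 1" and s: "s \<in> {1..n::nat} \<rightarrow> squarefree_elements G"
    and chain: "\<forall>i\<in>{1..<n}. s i divides s (i + 1)" and a: "a = (\<Otimes>i\<in>{1..n}. s i)"
    using assms unfolding cond_ii_def by blast
  have sc: "s \<in> {1..n} \<rightarrow> carrier G" using s squarefree_carrier by auto
  obtain t where t: "t \<in> {1..n} \<rightarrow> carrier G"
    and st: "\<And>i. i \<in> {1..n} \<Longrightarrow> s i = (\<Otimes>j\<in>{1..i}. t j)"
    using divides_chain_partial_products[OF chain sc] by blast
  \<comment> \<open>The product of all \<open>t j\<close> is the last chain element
    \<open>s n\<close>; its square-freeness controls each \<open>t j\<close> and each product of two
    of them.\<close>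
  have top: "(\<Otimes>j\<in>{1..n}. t j) \<in> squarefree_elements G"
    using funcset_mem[OF s, of n] st[of n] n by simp
  \<comment> \<open>In the product of the chain, \<open>t j\<close> has exponent
    \<open>n + 1 - j\<close>, while (iii) wants exponent \<open>i\<close> at index \<open>i\<close>;
    hence the reversal.\<close>
  define r where "r i = t (n + 1 - i)" for i
  have r: "r \<in> {1..n} \<rightarrow> squarefree_elements G"
  proof
    fix i assume "i \<in> {1..n}"
    then have "n + 1 - i \<in> {1..n}" by auto
    then show "r i \<in> squarefree_elements G"
      unfolding r_def using t top squarefree_divisor divides_finprod[OF t] by (meson PiE finite_atLeastAtMost)
  qed
  have rc: "r \<in> {1..n} \<rightarrow> carrier G" using r squarefree_carrier by auto
  have "rel_prime G (r i) (r j)" if "i \<in> {1..n}" "j \<in> {1..n}" "i \<noteq> j" for i j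
  proof (rule squarefree_mult_imp_rel_prime)
    show "r i \<in> carrier G" "r j \<in> carrier G" using rc that by auto
    have "r i \<otimes> r j divides (\<Otimes>j\<in>{1..n}. t j)"
      unfolding r_def using t that by (intro mult_divides_finprod) auto
    then show "r i \<otimes> r j \<in> squarefree_elements G"
      using top \<open>r i \<in> carrier G\<close> \<open>r j \<in> carrier G\<close> squarefree_divisor by blast
  qed
  moreover have "a = (\<Otimes>i\<in>{1..n}. r i [^] i)"
  proof -
    have "a = (\<Otimes>i\<in>{1..n}. \<Otimes>j\<in>{1..i}. r (n + 1 - j))"
      unfolding a
    proof (rule finprod_cong')
      fix i assume i: "i \<in> {1..n}"
      have "s i = (\<Otimes>j\<in>{1..i}. t j)" using st i by simp
      also have "\<dots> = (\<Otimes>j\<in>{1..i}. r (n + 1 - j))"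
        using i t by (intro finprod_cong') (auto simp: r_def Pi_iff)
      finally show "s i = (\<Otimes>j\<in>{1..i}. r (n + 1 - j))" .
    next
      show "(\<lambda>i. \<Otimes>j\<in>{1..i}. r (n + 1 - j)) \<in> {1..n} \<rightarrow> carrier G"
        by (auto intro!: finprod_closed funcset_mem[OF rc])
    qed simp
    then show ?thesis using finprod_triangle_rev[OF rc] by simp
  qed
  ultimately show "\<exists>n::nat\<ge>1. \<exists>s\<in>{1..n} \<rightarrow> squarefree_elements G.
      (\<forall>i\<in>{1..n}. \<forall>j\<in>{1..n}. i \<noteq> j \<longrightarrow> rel_prime G (s i) (s j)) \<and> a = (\<Otimes>i\<in>{1..n}. s i [^] i)"
    using n r by blast
qed

lemma finprod_divides_nat_pow:
  assumes "f \<in> {1..n::nat} \<rightarrow> carrier G" "c \<in> carrier G" "\<forall>i\<in>{1..n}. f i divides c"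
  shows "(\<Otimes>i\<in>{1..n}. f i) divides c [^] n"
  using assms(1,3)
proof (induction n)
  case (Suc n)
  have f: "f \<in> {1..n} \<rightarrow> carrier G" "f (Suc n) \<in> carrier G" using Suc.prems by auto
  have "(\<Otimes>i\<in>{1..n}. f i) \<otimes> f (Suc n) divides c [^] n \<otimes> f (Suc n)"
    using Suc f assms(2) by (intro divides_mult_rI) auto
  also have "c [^] n \<otimes> f (Suc n) divides c [^] n \<otimes> c"
    using Suc f assms(2) by (intro divides_mult_lI) auto
  finally show ?case
    using finprod_Suc_atLeastAtMost[OF Suc.prems(1)] f assms(2) by simp
qed simp

text \<open>The last chain element serves as \<open>c\<close>: all \<open>n\<close> factors divide
  it, so their product divides \<open>c [^] n\<close>.\<close>

lemma cond_ii_imp_cond_v: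
  assumes "cond_ii G"
  shows "cond_v G"
  unfolding cond_v_def
proof
  fix a assume "a \<in> carrier G"
  then obtain n s where n: "n \<ge> 1" and s: "s \<in> {1..n::nat} \<rightarrow> squarefree_elements G"
    and chain: "\<forall>i\<in>{1..<n}. s i divides s (i + 1)" and a: "a = (\<Otimes>i\<in>{1..n}. s i)"
    using assms unfolding cond_ii_def by blast
  have sc: "s \<in> {1..n} \<rightarrow> carrier G" using s squarefree_carrier by auto
  obtain m where m: "n = Suc m" using n by (cases n) auto
  have "a = (\<Otimes>i\<in>{1..m}. s i) \<otimes> s n"
    unfolding a m using sc m by (intro finprod_Suc_atLeastAtMost) auto
  moreover have "(\<Otimes>i\<in>{1..m}. s i) \<in> carrier G"
    using sc m by (intro finprod_closed) auto
  moreover have "a divides s n [^] n"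
    unfolding a using sc n divides_chain_mono[OF chain sc]
    by (intro finprod_divides_nat_pow) auto
  moreover have "s n \<in> squarefree_elements G" using s n by auto
  ultimately show "\<exists>b\<in>carrier G. \<exists>c\<in>squarefree_elements G.
      a = b \<otimes> c \<and> (\<exists>n::nat\<ge>1. a divides c [^] n)"
    using n by blast
qed

text \<open>Condition (iv) for a single element, the form in which it is proved by
  induction.\<close>

definition dyadic_product :: "'a \<Rightarrow> bool" where
  "dyadic_product a \<longleftrightarrow> (\<exists>n::nat. \<exists>s\<in>{0..n} \<rightarrow> squarefree_elements G.
     a = (\<Otimes>i\<in>{0..n}. s i [^] ((2::nat) ^ i)))"

lemma cond_iv_iff: "cond_iv G \<longleftrightarrow> (\<forall>a\<in>carrier G. dyadic_product a)"
  unfolding cond_iv_def dyadic_product_def ..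

text \<open>For positive index the exponent \<open>2 ^ i\<close> is even, so a square splits off and
  only \<open>s 0\<close> remains. This links (iv) with the shape \<open>b [^] 2 \<otimes> c\<close>
  of (vi).\<close>

lemma finprod_dyadic_Suc:
  assumes "s \<in> {0..Suc n} \<rightarrow> carrier G"
  shows "(\<Otimes>i\<in>{0..Suc n}. s i [^] ((2::nat) ^ i)) =
         (\<Otimes>i\<in>{0..n}. s (Suc i) [^] ((2::nat) ^ i)) [^] (2::nat) \<otimes> s 0"
proof -
  have s: "s 0 \<in> carrier G" "(\<lambda>i. s (Suc i)) \<in> {..n} \<rightarrow> carrier G"
    using assms by (auto simp: Pi_iff)
  have "(\<Otimes>i\<in>{..Suc n}. s i [^] ((2::nat) ^ i)) =
        (\<Otimes>i\<in>{..n}. s (Suc i) [^] ((2::nat) ^ Suc i)) \<otimes> s 0 [^] ((2::nat) ^ 0)"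
    using assms by (intro finprod_Suc2) (auto simp: Pi_iff)
  also have "(\<Otimes>i\<in>{..n}. s (Suc i) [^] ((2::nat) ^ Suc i)) =
             (\<Otimes>i\<in>{..n}. (s (Suc i) [^] ((2::nat) ^ i)) [^] (2::nat))"
    using s by (intro finprod_cong') (auto simp: nat_pow_pow mult.commute Pi_iff)
  also have "\<dots> = (\<Otimes>i\<in>{..n}. s (Suc i) [^] ((2::nat) ^ i)) [^] (2::nat)"
    using s by (intro finprod_nat_pow) auto
  finally show ?thesis using s by (simp add: atMost_atLeast0)
qed

lemma dyadic_product_squarefree: "c \<in> squarefree_elements G \<Longrightarrow> dyadic_product c"
  unfolding dyadic_product_def using squarefree_carrier
  by (auto intro!: exI[of _ 0] bexI[of _ "\<lambda>_. c"])

lemma dyadic_product_square_mult: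
  assumes "dyadic_product b" "c \<in> squarefree_elements G"
  shows "dyadic_product (b [^] (2::nat) \<otimes> c)"
proof -
  obtain n s where s: "s \<in> {0..n::nat} \<rightarrow> squarefree_elements G"
      "b = (\<Otimes>i\<in>{0..n}. s i [^] ((2::nat) ^ i))"
    using assms(1) unfolding dyadic_product_def by blast
  \<comment> \<open>Squaring \<open>b\<close> moves every \<open>s i\<close> to index
    \<open>Suc i\<close>, and \<open>c\<close> takes the vacated index \<open>0\<close>.\<close>
  let ?t = "case_nat c s"
  have t: "?t \<in> {0..Suc n} \<rightarrow> squarefree_elements G"
    using s assms(2) by (auto simp: Pi_iff split: nat.split)
  have "(\<Otimes>i\<in>{0..Suc n}. ?t i [^] ((2::nat) ^ i)) = b [^] (2::nat) \<otimes> c"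
    using finprod_dyadic_Suc[of ?t n] t squarefree_carrier s(2) by auto
  then show ?thesis unfolding dyadic_product_def using t by metis
qed

lemma cond_iv_imp_cond_vi:
  assumes "cond_iv G"
  shows "cond_vi G"
  unfolding cond_vi_def
proof
  fix a assume "a \<in> carrier G"
  then obtain n s where s: "s \<in> {0..n::nat} \<rightarrow> squarefree_elements G"
      and a: "a = (\<Otimes>i\<in>{0..n}. s i [^] ((2::nat) ^ i))"
    using assms unfolding cond_iv_def by blast
  have sc: "s \<in> {0..n} \<rightarrow> carrier G" using s squarefree_carrier by auto
  show "\<exists>b\<in>carrier G. \<exists>c\<in>squarefree_elements G. a = b [^] (2::nat) \<otimes> c"
  proof (cases n)
    \<comment> \<open>Only \<open>s 0\<close> with exponent \<open>1\<close> is present, so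
      \<open>b\<close> is \<open>\<one>\<close>.\<close>
    case 0
    then show ?thesis
      using s sc a by (intro bexI[of _ \<one>] bexI[of _ "s 0"]) (auto simp: Pi_iff)
  next
    case (Suc m)
    have "a = (\<Otimes>i\<in>{0..m}. s (Suc i) [^] ((2::nat) ^ i)) [^] (2::nat) \<otimes> s 0"
      unfolding a Suc using sc Suc by (intro finprod_dyadic_Suc) auto
    moreover have "(\<Otimes>i\<in>{0..m}. s (Suc i) [^] ((2::nat) ^ i)) \<in> carrier G"
      using sc Suc by (intro finprod_closed) auto
    moreover have "s 0 \<in> squarefree_elements G" using s by auto
    ultimately show ?thesis by blast
  qed
qed

section \<open>The ascending chain condition\<close>

text \<open>An infinite sequence of proper divisors gives an ascending chain of principal ideals.
  Where it stabilizes, \<open>f N\<close> divides its own proper divisor \<open>f (Suc N)\<close>.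
  Arguments under ACCP thus become well-founded inductions.\<close>

lemma ACCP_imp_divisor_chain_condition:
  assumes "ACCP G"
  shows "divisor_chain_condition_monoid G"
proof
  show "wf {(x, y). x \<in> carrier G \<and> y \<in> carrier G \<and> properfactor G x y}"
    unfolding wf_iff_no_infinite_down_chain
  proof clarify
    fix f :: "nat \<Rightarrow> 'a"
    assume f: "\<forall>i. (f (Suc i), f i) \<in> {(x, y). x \<in> carrier G \<and> y \<in> carrier G \<and> properfactor G x y}"
    then have fc: "f i \<in> carrier G" for i by auto
    have pf: "properfactor G (f (Suc i)) (f i)" for i using f by auto
    have "f i <# carrier G \<subseteq> f (Suc i) <# carrier G" for i
    proof -
      have "f (Suc i) divides f i" using pf[of i] by (rule properfactor_divides)
      then obtain c where "c \<in> carrier G" "f i = f (Suc i) \<otimes> c" by auto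
      then show ?thesis
        unfolding l_coset_def using fc by (auto simp: m_assoc)
    qed
    then obtain N where N: "\<forall>i\<ge>N. f i <# carrier G = f N <# carrier G"
      using assms fc unfolding ACCP_def by blast
    have "f (Suc N) \<in> f (Suc N) <# carrier G"
      unfolding l_coset_def using fc[of "Suc N"] r_one[of "f (Suc N)"] one_closed by fastforce
    moreover have "f (Suc N) <# carrier G = f N <# carrier G"
      using N[rule_format, of "Suc N"] by simp
    ultimately have "f (Suc N) \<in> f N <# carrier G" by simp
    then have "f N divides f (Suc N)"
      unfolding l_coset_def by auto
    then show False using pf[of N] by (auto elim: properfactorE)
  qed
qed

end

context divisor_chain_condition_monoid
begin

lemma properfactor_induct [consumes 1, case_names less]:
  assumes "a \<in> carrier G"
    and "\<And>x. \<lbrakk>x \<in> carrier G; \<And>y. \<lbrakk>y \<in> carrier G; properfactor G y x\<rbrakk> \<Longrightarrow> P y\<rbrakk> \<Longrightarrow> P x"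
  shows "P a"
proof -
  have "a \<in> carrier G \<longrightarrow> P a"
    using division_wellfounded
  proof (induction a rule: wf_induct_rule)
    case (less x)
    then show ?case using assms(2)[of x] by blast
  qed
  then show ?thesis using assms(1) by blast
qed

lemma atomic: "atomic G"
proof -
  have atoms: "atoms G \<subseteq> carrier G" unfolding atoms_def by auto
  have "a \<in> Units G \<or> a \<in> finite_products G (atoms G)" if "a \<in> carrier G" for a
    using that
  proof (induction a rule: properfactor_induct)
    case (less x)
    show ?case
    proof (cases "x \<in> Units G \<or> x \<in> atoms G")
      case True
      then show ?thesis using finite_products_incl[OF atoms] by blast
    next
      case False
      then obtain b c where bc: "b \<in> carrier G" "c \<in> carrier G" "b \<notin> Units G" "c \<notin> Units G" "x = b \<otimes> c"
        using less.hyps unfolding atoms_def by blast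
      \<comment> \<open>Each factor is a proper divisor because its cofactor is not
        invertible.\<close>
      have "properfactor G b x" "properfactor G c x"
        using bc properfactorI3[of x b c] properfactorI3[of x c b] by (auto simp: m_comm)
      then have "b \<in> finite_products G (atoms G)" "c \<in> finite_products G (atoms G)"
        using less.IH bc by auto
      then show ?thesis using bc finite_products_mult[OF atoms] by blast
    qed
  qed
  then show ?thesis unfolding atomic_iff by blast
qed

text \<open>If \<open>x\<close> is not square-free, split off a square of a non-unit
  \<open>b\<close>. The cofactor \<open>c\<close> is then a proper divisor of \<open>x\<close>, and
  the square found for it by induction merges with that of \<open>b\<close>.\<close>

lemma cond_vi: "cond_vi G"
  unfolding cond_vi_def
proof
  fix a assume "a \<in> carrier G"
  then show "\<exists>b\<in>carrier G. \<exists>c\<in>squarefree_elements G. a = b [^] (2::nat) \<otimes> c"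
  proof (induction a rule: properfactor_induct)
    case (less x)
    show ?case
    proof (cases "x \<in> squarefree_elements G")
      case True
      then show ?thesis
        using less by (intro bexI[of _ \<one>] bexI[of _ x]) auto
    next
      case False
      then obtain b c where bc: "b \<in> carrier G" "c \<in> carrier G" "b \<notin> Units G"
          "x = b [^] (2::nat) \<otimes> c"
        using less.hyps unfolding squarefree_elements_def by blast
      have "b [^] (2::nat) \<notin> Units G"
        using bc unit_factor[of b b] by (auto simp: numeral_2_eq_2)
      then have "properfactor G c x"
        using bc by (intro properfactorI3[of x c "b [^] (2::nat)"]) (auto simp: m_comm)
      then obtain d e where de: "d \<in> carrier G" "e \<in> squarefree_elements G" "c = d [^] (2::nat) \<otimes> e"
        using less.IH bc by blast
      have "x = (b \<otimes> d) [^] (2::nat) \<otimes> e"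
        using bc de squarefree_carrier by (auto simp: nat_pow_distrib m_assoc)
      then show ?thesis using bc de by blast
    qed
  qed
qed

lemma cond_iv: "cond_iv G"
  unfolding cond_iv_iff
proof
  fix a assume "a \<in> carrier G"
  then show "dyadic_product a"
  proof (induction a rule: properfactor_induct)
    case (less x)
    show ?case
    proof (cases "x \<in> squarefree_elements G")
      case True
      then show ?thesis by (rule dyadic_product_squarefree)
    next
      case False
      obtain b c where bc: "b \<in> carrier G" "c \<in> squarefree_elements G" "x = b [^] (2::nat) \<otimes> c"
        using less.hyps cond_vi unfolding cond_vi_def by blast
      have c: "c \<in> carrier G" using bc squarefree_carrier by auto
      have x: "x = b \<otimes> (b \<otimes> c)" using bc c by (simp add: numeral_2_eq_2 m_assoc)
      \<comment> \<open>With \<open>b\<close> invertible, \<open>x\<close> would divide the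
        square-free \<open>c\<close> and be square-free itself, against the case assumption.
        Therefore \<open>b \<otimes> c\<close> is no unit and \<open>b\<close> is a proper divisor
        of \<open>x\<close>.\<close>
      have "b \<notin> Units G"
      proof
        assume b: "b \<in> Units G"
        have "x divides c"
          using unit_mult_divides[of "b \<otimes> b" c] b bc c x by (simp add: m_assoc)
        then show False using False bc squarefree_divisor less.hyps by blast
      qed
      then have "b \<otimes> c \<notin> Units G" using bc c unit_factor by blast
      then have "properfactor G b x"
        using x bc c by (intro properfactorI3[of x b "b \<otimes> c"]) auto
      then show ?thesis using less.IH bc dyadic_product_square_mult by simp
    qed
  qed
qed

end

section \<open>Decomposition monoids\<close>

context decomposition_monoid
begin

text \<open>Decomposition splits a common divisor of \<open>z\<close> and
  \<open>x \<otimes> y\<close> into a divisor of \<open>x\<close> and one of \<open>y\<close>; both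
  also divide \<open>z\<close>, so both are units.\<close>

lemma rel_prime_mult:
  assumes "rel_prime G z x" "rel_prime G z y" "x \<in> carrier G" "y \<in> carrier G"
  shows "rel_prime G z (x \<otimes> y)"
  unfolding rel_prime_def
proof clarify
  fix d assume d: "d \<in> carrier G" "d \<notin> Units G" "d divides z" "d divides x \<otimes> y"
  then obtain d1 d2 where dd: "d1 \<in> carrier G" "d2 \<in> carrier G" "d = d1 \<otimes> d2"
      "d1 divides x" "d2 divides y"
    using decomposition assms by blast
  have "d1 divides d" "d2 divides d" using dd by (auto intro: divides_prod_l)
  then have "d1 divides z" "d2 divides z" using d dd by (meson divides_trans)+
  then have "d1 \<in> Units G" "d2 \<in> Units G" using dd assms rel_primeD by blast+
  then show False using d dd by auto
qed

lemma rel_prime_finprod: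
  assumes "f \<in> A \<rightarrow> carrier G" "\<And>i. i \<in> A \<Longrightarrow> rel_prime G z (f i)"
  shows "rel_prime G z (\<Otimes>i\<in>A. f i)"
  using assms
proof (induction A rule: infinite_finite_induct)
  case (insert i A)
  then show ?case using rel_prime_mult by (auto simp: Pi_iff)
\<comment> \<open>Over an empty or infinite index set \<open>finprod\<close> is
  \<open>\<one>\<close>, all of whose divisors are units.\<close>
qed (auto simp: rel_prime_def Unit_eq_dividesone)

text \<open>Euclid's lemma: the part of \<open>a\<close> that divides \<open>b\<close> is a common
  divisor of \<open>a\<close> and \<open>b\<close>, hence a unit, and the other part divides
  \<open>c\<close>.\<close>

lemma rel_prime_divides_mult:
  assumes "rel_prime G a b" "a divides b \<otimes> c"
    and "a \<in> carrier G" "b \<in> carrier G" "c \<in> carrier G"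
  shows "a divides c"
proof -
  obtain p q where pq: "p \<in> carrier G" "q \<in> carrier G" "a = p \<otimes> q" "p divides b" "q divides c"
    using decomposition assms by blast
  then have "p \<in> Units G" using assms rel_primeD by blast
  then have "a divides q" using pq unit_mult_divides by simp
  then show ?thesis using pq assms by (meson divides_trans)
qed

text \<open>If \<open>b \<otimes> b\<close> divides \<open>x \<otimes> y\<close>, decompose
  \<open>b\<close> into a divisor \<open>b1\<close> of \<open>x\<close> and a divisor
  \<open>b2\<close> of \<open>y\<close>; by symmetry it suffices to treat a square whose root
  divides one of the two factors.\<close>

lemma squarefree_mult:
  assumes x: "x \<in> squarefree_elements G" and y: "y \<in> squarefree_elements G" and "rel_prime G x y"
  shows "x \<otimes> y \<in> squarefree_elements G"
proof -
  have xyc: "x \<in> carrier G" "y \<in> carrier G" using x y squarefree_carrier by auto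
  \<comment> \<open>Cancel \<open>d\<close> from \<open>x = d \<otimes> x'\<close> and decompose
    \<open>d\<close> along \<open>x' \<otimes> y\<close>: the part \<open>d2\<close> divides both
    \<open>x\<close> and \<open>y\<close>, and the square of \<open>d1\<close> divides
    \<open>d \<otimes> x' = x\<close>. The variables are bound afresh so that \<open>x\<close> and
    \<open>y\<close> can be swapped.\<close>
  have unit: "d \<in> Units G"
    if x: "x \<in> squarefree_elements G" and y: "y \<in> squarefree_elements G" and xy: "rel_prime G x y"
      and d: "d \<in> carrier G" "d divides x" "d \<otimes> d divides x \<otimes> y" for x y d
  proof -
    have c: "x \<in> carrier G" "y \<in> carrier G" using x y squarefree_carrier by auto
    obtain x' where x': "x' \<in> carrier G" "x = d \<otimes> x'" using d by auto
    have "d \<otimes> d divides d \<otimes> (x' \<otimes> y)" using d x' c by (simp add: m_assoc)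
    then have "d divides x' \<otimes> y" using d x' c by simp
    then obtain d1 d2 where dd: "d1 \<in> carrier G" "d2 \<in> carrier G" "d = d1 \<otimes> d2"
      "d1 divides x'" "d2 divides y"
      using decomposition[OF d(1) x'(1) c(2)] by blast
    have "d1 divides d" "d2 divides d" using dd by (auto intro: divides_prod_l)
    then have "d2 divides x" using d dd by (meson divides_trans)
    then have "d2 \<in> Units G" using dd xy rel_primeD by blast
    moreover have "d1 \<in> Units G"
    proof -
      have "d1 \<otimes> d1 divides d \<otimes> d1" using \<open>d1 divides d\<close> d dd by auto
      also have "d \<otimes> d1 divides d \<otimes> x'" using d dd x' by auto
      finally have "d1 \<otimes> d1 divides x" using x' d dd by simp
      then show ?thesis using x dd unfolding squarefree_iff by blast
    qed
    ultimately show ?thesis using dd by simp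
  qed
  have "b \<in> Units G" if b: "b \<in> carrier G" "b \<otimes> b divides x \<otimes> y" for b
  proof -
    have "b divides x \<otimes> y" using b xyc by (meson dividesI' divides_trans m_closed)
    then obtain b1 b2 where bb: "b1 \<in> carrier G" "b2 \<in> carrier G" "b = b1 \<otimes> b2"
      "b1 divides x" "b2 divides y"
      using decomposition[OF b(1) xyc] by blast
    have "b \<otimes> b = (b1 \<otimes> b1) \<otimes> (b2 \<otimes> b2)" using bb by (simp add: m_ac)
    then have "b1 \<otimes> b1 divides b \<otimes> b" "b2 \<otimes> b2 divides b \<otimes> b" 
      using bb by (auto intro: divides_prod_l divides_prod_r)
    then have "b1 \<otimes> b1 divides x \<otimes> y" "b2 \<otimes> b2 divides y \<otimes> x"
      using b bb xyc by (auto simp: m_comm[of y x] intro: divides_trans[of _ "b \<otimes> b"])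
    then have "b1 \<in> Units G" "b2 \<in> Units G"
      using unit[of x y b1] unit[of y x b2] assms bb rel_prime_sym by auto
    then show ?thesis using bb by simp
  qed
  then show ?thesis unfolding squarefree_iff using xyc by auto
qed

lemma squarefree_finprod:
  assumes "f \<in> A \<rightarrow> squarefree_elements G"
    and "\<And>i j. \<lbrakk>i \<in> A; j \<in> A; i \<noteq> j\<rbrakk> \<Longrightarrow> rel_prime G (f i) (f j)"
  shows "(\<Otimes>i\<in>A. f i) \<in> squarefree_elements G"
  using assms
proof (induction A rule: infinite_finite_induct)
  case (insert i A)
  have f: "f \<in> A \<rightarrow> carrier G" "f i \<in> carrier G"
    using insert.prems squarefree_carrier by auto
  have "rel_prime G (f i) (\<Otimes>i\<in>A. f i)"
    using f insert by (intro rel_prime_finprod) auto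
  then show ?case
    using f insert by (auto intro!: squarefree_mult)
qed (auto simp: one_squarefree)

lemma cond_iii_imp_cond_ii:
  assumes "cond_iii G"
  shows "cond_ii G"
  unfolding cond_ii_def
proof
  fix a assume "a \<in> carrier G"
  then obtain n s where n: "n \<ge> 1" and s: "s \<in> {1..n::nat} \<rightarrow> squarefree_elements G"
    and rp: "\<forall>i\<in>{1..n}. \<forall>j\<in>{1..n}. i \<noteq> j \<longrightarrow> rel_prime G (s i) (s j)"
    and a: "a = (\<Otimes>i\<in>{1..n}. s i [^] i)"
    using assms unfolding cond_iii_def by blast
  have sc: "s \<in> {1..n} \<rightarrow> carrier G" using s squarefree_carrier by auto
  \<comment> \<open>\<open>t i\<close> collects the \<open>i\<close> factors of largest index, so
    \<open>s k\<close> enters exactly the \<open>k\<close> products \<open>t i\<close> with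
    \<open>i \<ge> n + 1 - k\<close>.\<close>
  define t where "t i = (\<Otimes>j\<in>{1..i}. s (n + 1 - j))" for i
  have "t \<in> {1..n} \<rightarrow> squarefree_elements G"
    unfolding t_def 
  proof (intro Pi_I squarefree_finprod)
    fix i j k assume i: "i \<in> {1..n}" and "j \<in> {1..i}"
    then have j: "n + 1 - j \<in> {1..n}" by auto
    then show "s (n + 1 - j) \<in> squarefree_elements G" using s by blast
    assume "k \<in> {1..i}" "j \<noteq> k"
    then have "n + 1 - k \<in> {1..n}" "n + 1 - j \<noteq> n + 1 - k" using i \<open>j \<in> {1..i}\<close> by auto
    then show "rel_prime G (s (n + 1 - j)) (s (n + 1 - k))" using rp j by blast
  qed
  moreover have "a = (\<Otimes>i\<in>{1..n}. t i)"
    unfolding a t_def using finprod_triangle_rev[OF sc] by simp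
  moreover have "t i divides t (i + 1)" if i: "i \<in> {1..<n}" for i
  proof -
    have "t (Suc i) = t i \<otimes> s (n + 1 - Suc i)"
      unfolding t_def using i
      by (intro finprod_Suc_atLeastAtMost) (auto intro!: funcset_mem[OF sc])
    then show ?thesis using i sc by (auto simp: Pi_iff)
  qed
  ultimately show "\<exists>n::nat\<ge>1. \<exists>s\<in>{1..n} \<rightarrow> squarefree_elements G.
      (\<forall>i\<in>{1..<n}. s i divides s (i + 1)) \<and> a = (\<Otimes>i\<in>{1..n}. s i)"
    using n by blast
qed

text \<open>Induction on the number of binary digits of the exponents. The lowest digits select the
  \<open>s i\<close> of odd exponent, whose product is square-free; the halved exponents give an
  element whose square accounts for the rest.\<close>

lemma dyadic_product_finprod:
  assumes "finite A" "s \<in> A \<rightarrow> squarefree_elements G"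
    and rp: "\<And>i j. \<lbrakk>i \<in> A; j \<in> A; i \<noteq> j\<rbrakk> \<Longrightarrow> rel_prime G (s i) (s j)"
    and "\<And>i. i \<in> A \<Longrightarrow> e i < (2::nat) ^ m"
  shows "dyadic_product (\<Otimes>i\<in>A. s i [^] e i)"
  using assms(4)
proof (induction m arbitrary: e)
  case 0
  have "(\<Otimes>i\<in>A. s i [^] e i) = \<one>"
    using 0 by (intro finprod_one_eqI) auto
  then show ?case by (simp add: one_squarefree dyadic_product_squarefree)
next
  case (Suc m)
  have sc: "s \<in> A \<rightarrow> carrier G" using assms(2) squarefree_carrier by auto
  have pow01: "s i [^] (e i mod 2) = (if even (e i) then \<one> else s i)" if "i \<in> A" for i
    using sc that by (auto simp: odd_iff_mod_2_eq_one Pi_iff)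
  have "s i [^] e i = (s i [^] (e i div 2)) [^] (2::nat) \<otimes> s i [^] (e i mod 2)" if "i \<in> A" for i
    using sc that by (auto simp: nat_pow_pow nat_pow_mult Pi_iff)
  then have "(\<Otimes>i\<in>A. s i [^] e i) =
      (\<Otimes>i\<in>A. (s i [^] (e i div 2)) [^] (2::nat) \<otimes> s i [^] (e i mod 2))"
    using sc by (intro finprod_cong') (auto simp: Pi_iff)
  also have "\<dots> = (\<Otimes>i\<in>A. s i [^] (e i div 2)) [^] (2::nat) \<otimes> (\<Otimes>i\<in>A. s i [^] (e i mod 2))"
    using sc by (subst finprod_multf) (auto simp: finprod_nat_pow Pi_iff)
  finally have eq: "(\<Otimes>i\<in>A. s i [^] e i) = \<dots>" .
  have "(\<Otimes>i\<in>A. s i [^] (e i mod 2)) \<in> squarefree_elements G"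
  proof (rule squarefree_finprod)
    show "(\<lambda>i. s i [^] (e i mod 2)) \<in> A \<rightarrow> squarefree_elements G"
      using assms(2) by (auto simp: pow01 one_squarefree)
    show "rel_prime G (s i [^] (e i mod 2)) (s j [^] (e j mod 2))"
      if "i \<in> A" "j \<in> A" "i \<noteq> j" for i j
      using rp[OF that] that pow01
      by (auto simp: rel_prime_def Unit_eq_dividesone)
  qed
  moreover have "dyadic_product (\<Otimes>i\<in>A. s i [^] (e i div 2))"
    using Suc.prems by (intro Suc.IH) (auto simp: less_mult_imp_div_less mult.commute)
  ultimately show ?case unfolding eq by (rule dyadic_product_square_mult[rotated])
qed

lemma cond_iii_imp_cond_iv:
  assumes "cond_iii G"
  shows "cond_iv G"
  unfolding cond_iv_iff
proof
  fix a assume "a \<in> carrier G"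
  then obtain n s where s: "s \<in> {1..n::nat} \<rightarrow> squarefree_elements G"
    and rp: "\<forall>i\<in>{1..n}. \<forall>j\<in>{1..n}. i \<noteq> j \<longrightarrow> rel_prime G (s i) (s j)"
    and a: "a = (\<Otimes>i\<in>{1..n}. s i [^] i)"
    using assms unfolding cond_iii_def by blast
  \<comment> \<open>Since \<open>i \<le> n < 2 ^ n\<close>, \<open>n\<close> binary digits suffice
    for all exponents.\<close>
  show "dyadic_product a"
    unfolding a using s rp
    by (intro dyadic_product_finprod[where m = n]) (auto intro: le_less_trans[OF _ less_exp])
qed

end

section \<open>GCD-monoids\<close>

context gcd_condition_monoid
begin

text \<open>A common divisor \<open>d\<close> of the cofactors makes \<open>g \<otimes> d\<close> a
  common divisor of \<open>a\<close> and \<open>b\<close>, so it divides \<open>g\<close>;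
  cancelling \<open>g\<close> shows that \<open>d\<close> is a unit.\<close>

lemma gcd_cofactors:
  assumes "a \<in> carrier G" "b \<in> carrier G"
  obtains g a' b' where "g \<in> carrier G" "a' \<in> carrier G" "b' \<in> carrier G"
    "a = g \<otimes> a'" "b = g \<otimes> b'" "rel_prime G a' b'"
proof -
  obtain g where g: "g \<in> carrier G" "g gcdof a b" using gcdof_exists assms by blast
  then obtain a' b' where ab: "a' \<in> carrier G" "b' \<in> carrier G" "a = g \<otimes> a'" "b = g \<otimes> b'"
    unfolding isgcd_def by (auto elim!: dividesE)
  have "rel_prime G a' b'"
    unfolding rel_prime_def
  proof clarify
    fix d assume d: "d \<in> carrier G" "d \<notin> Units G" "d divides a'" "d divides b'"
    then have "g \<otimes> d divides a" "g \<otimes> d divides b" using g ab by auto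
    then have "g \<otimes> d divides g \<otimes> \<one>" using g d unfolding isgcd_def by auto
    then have "d divides \<one>" using g d by (subst (asm) divides_mult_l) auto
    then show False using d Unit_eq_dividesone by blast
  qed
  then show thesis using that g ab by blast
qed

text \<open>The parts of \<open>a\<close> are its gcd \<open>g\<close> with \<open>b\<close> and the
  cofactor \<open>a'\<close>. It remains to see that \<open>a'\<close>, relatively prime to
  \<open>b'\<close>, divides \<open>c\<close>.\<close>

lemma decomposition_monoid: "decomposition_monoid G"
proof
  fix a b c
  assume abc: "a \<in> carrier G" "b \<in> carrier G" "c \<in> carrier G" "a divides b \<otimes> c"
  obtain g a' b' where g: "g \<in> carrier G" "a' \<in> carrier G" "b' \<in> carrier G"
    "a = g \<otimes> a'" "b = g \<otimes> b'" "rel_prime G a' b'"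
    using gcd_cofactors[OF abc(1,2)] .
  have "g \<otimes> a' divides g \<otimes> (b' \<otimes> c)" using abc g by (simp add: m_assoc)
  then have "a' divides b' \<otimes> c" using abc g by simp
  then have "a' divides c \<otimes> b'" using abc g by (simp add: m_comm)
  moreover have "a' divides c \<otimes> a'" using abc g by (simp add: divides_prod_l)
  \<comment> \<open>This gcd is associated to \<open>c\<close> times the gcd of \<open>a'\<close>
    and \<open>b'\<close>, and the latter is a unit.\<close>
  ultimately have "a' divides somegcd G (c \<otimes> a') (c \<otimes> b')"
    using abc g by (intro gcd_divides) auto
  also have "somegcd G (c \<otimes> a') (c \<otimes> b') \<sim> c \<otimes> somegcd G a' b'"
    using abc g gcd_mult associated_sym by blast
  finally have "a' divides c \<otimes> somegcd G a' b'" using g by simp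
  moreover have "somegcd G a' b' \<in> Units G"
    using g by (intro rel_primeD[OF g(6)]) (auto intro: gcd_divides_l gcd_divides_r)
  then have "c \<otimes> somegcd G a' b' divides c"
    using abc unit_mult_divides[of "somegcd G a' b'" c] m_comm[of c "somegcd G a' b'"] by auto
  ultimately have "a' divides c" using g by (meson divides_trans)
  then show "\<exists>a1\<in>carrier G. \<exists>a2\<in>carrier G. a = a1 \<otimes> a2 \<and> a1 divides b \<and> a2 divides c"
    using g by (intro bexI[of _ g] bexI[of _ a']) auto
qed

end

sublocale gcd_condition_monoid \<subseteq> decomposition_monoid
  by (rule decomposition_monoid)

section \<open>Least common multiples and insertion into divisor chains\<close>

context gcd_condition_monoid
begin

text \<open>Here \<open>g\<close> is the gcd and \<open>l = c \<otimes> t'\<close> the lcm. As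
  \<open>g \<otimes> t' = t\<close> is square-free, \<open>t'\<close> is relatively prime to
  \<open>g\<close>; it is so to \<open>c'\<close> too, hence to \<open>c\<close>, and
  \<open>l\<close> is square-free.\<close>

lemma squarefree_gcd_lcm:
  assumes "c \<in> squarefree_elements G" "t \<in> squarefree_elements G"
  obtains g l where "g \<in> squarefree_elements G" "l \<in> squarefree_elements G"
    "c \<otimes> t = g \<otimes> l" "g divides t" "t divides l"
    "\<And>x. \<lbrakk>x \<in> carrier G; c divides x; t divides x\<rbrakk> \<Longrightarrow> l divides x"
proof -
  have ct: "c \<in> carrier G" "t \<in> carrier G" using assms squarefree_carrier by auto
  obtain g c' t' where g: "g \<in> carrier G" "c' \<in> carrier G" "t' \<in> carrier G"
    "c = g \<otimes> c'" "t = g \<otimes> t'" "rel_prime G c' t'"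
    using gcd_cofactors[OF ct] .
  have "rel_prime G t' g"
    using squarefree_mult_imp_rel_prime[of g t'] assms(2) g rel_prime_sym by blast
  then have tc: "rel_prime G t' c"
    unfolding g(4) using g rel_prime_mult rel_prime_sym by blast
  define l where "l = c \<otimes> t'"
  have "t' \<in> squarefree_elements G"
    using assms(2) g by (intro squarefree_divisor[OF assms(2)]) (auto simp: divides_prod_l)
  then have "l \<in> squarefree_elements G"
    unfolding l_def using assms(1) tc rel_prime_sym by (intro squarefree_mult) auto
  moreover have "g divides t" using g by auto
  moreover from this have "g \<in> squarefree_elements G"
    using assms(2) g squarefree_divisor by blast
  moreover have "c \<otimes> t = g \<otimes> l"
    using g by (simp add: l_def m_ac)
  moreover have "t divides l"
    using g by (intro dividesI[of c']) (auto simp: l_def m_ac)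
  \<comment> \<open>Writing \<open>x = c \<otimes> y\<close>, Euclid's lemma gives that
    \<open>t'\<close> divides \<open>y\<close>.\<close>
  moreover have "l divides x" if x: "x \<in> carrier G" "c divides x" "t divides x" for x
  proof -
    obtain y where y: "y \<in> carrier G" "x = c \<otimes> y" using x by auto
    have "t' divides t" using g by (simp add: divides_prod_l)
    then have "t' divides c \<otimes> y" using x y g by (meson divides_trans)
    then have "t' divides y" using tc rel_prime_divides_mult y g ct by blast
    then show ?thesis unfolding l_def y using y g ct by auto
  qed
  ultimately show thesis using that by blast
qed

text \<open>The conclusion on common multiples \<open>x\<close> lets the induction place the new chain below an lcm.\<close>

lemma divides_chain_insert:
  assumes "c \<in> squarefree_elements G" "s \<in> {1..n::nat} \<rightarrow> squarefree_elements G"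
    and "\<forall>i\<in>{1..<n}. s i divides s (i + 1)"
  shows "\<exists>r\<in>{1..Suc n} \<rightarrow> squarefree_elements G.
    (\<forall>i\<in>{1..<Suc n}. r i divides r (i + 1)) \<and>
    (\<Otimes>i\<in>{1..Suc n}. r i) = (\<Otimes>i\<in>{1..n}. s i) \<otimes> c \<and>
    (\<forall>x\<in>carrier G. c divides x \<longrightarrow> (\<forall>i\<in>{1..n}. s i divides x) \<longrightarrow> (\<forall>i\<in>{1..Suc n}. r i divides x))"
  using assms
proof (induction n arbitrary: c)
  case 0
  then show ?case
    using squarefree_carrier by (intro bexI[of _ "\<lambda>_. c"]) auto
next
  case (Suc n)
  have t: "s (Suc n) \<in> squarefree_elements G" using Suc.prems by auto
  have sc: "s \<in> {1..Suc n} \<rightarrow> carrier G" using Suc.prems squarefree_carrier by auto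
  then have sc': "s \<in> {1..n} \<rightarrow> carrier G" by auto
  obtain g l where g: "g \<in> squarefree_elements G" and l: "l \<in> squarefree_elements G"
    and eq: "c \<otimes> s (Suc n) = g \<otimes> l" and gt: "g divides s (Suc n)" and tl: "s (Suc n) divides l"
    and lcm: "\<And>x. \<lbrakk>x \<in> carrier G; c divides x; s (Suc n) divides x\<rbrakk> \<Longrightarrow> l divides x"
    using squarefree_gcd_lcm[OF Suc.prems(1) t] by blast
  \<comment> \<open>The gcd \<open>g\<close> is inserted into the chain without its top
    element.\<close>
  obtain r where r: "r \<in> {1..Suc n} \<rightarrow> squarefree_elements G"
    and chain: "\<forall>i\<in>{1..<Suc n}. r i divides r (i + 1)"
    and prod: "(\<Otimes>i\<in>{1..Suc n}. r i) = (\<Otimes>i\<in>{1..n}. s i) \<otimes> g"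
    and mult: "\<And>x. \<lbrakk>x \<in> carrier G; g divides x; \<forall>i\<in>{1..n}. s i divides x\<rbrakk>
      \<Longrightarrow> \<forall>i\<in>{1..Suc n}. r i divides x"
    using Suc.IH[OF g] Suc.prems by (auto simp: Pi_iff)
  have carr: "c \<in> carrier G" "g \<in> carrier G" "l \<in> carrier G" "s (Suc n) \<in> carrier G"
    "(\<Otimes>i\<in>{1..n}. s i) \<in> carrier G"
    using Suc.prems(1) g l t squarefree_carrier sc' by auto
  \<comment> \<open>The old top \<open>s (Suc n)\<close> is a common multiple of \<open>g\<close>
    and all lower elements, so the new chain stays below it and hence below
    \<open>l\<close>.\<close>
  have rt: "\<forall>i\<in>{1..Suc n}. r i divides s (Suc n)"
    using carr gt divides_chain_mono[OF Suc.prems(3) sc, of _ "Suc n"] by (intro mult) auto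
  have rl: "r i divides l" if "i \<in> {1..Suc n}" for i
  proof -
    have "r i \<in> carrier G" using r squarefree_carrier that by auto
    then show ?thesis using rt tl that by (meson divides_trans)
  qed
  \<comment> \<open>The lcm \<open>l\<close> becomes the new top, in place of
    \<open>s (Suc n)\<close>.\<close>
  let ?r = "r(Suc (Suc n) := l)"
  have r': "?r \<in> {1..Suc (Suc n)} \<rightarrow> squarefree_elements G"
    using r l by (auto simp: Pi_iff)
  then have rc: "?r \<in> {1..Suc (Suc n)} \<rightarrow> carrier G" using squarefree_carrier by auto
  have "?r i divides ?r (i + 1)" if "i \<in> {1..<Suc (Suc n)}" for i
    using that chain rl by (cases "i = Suc n") auto
  moreover have "(\<Otimes>i\<in>{1..Suc (Suc n)}. ?r i) = (\<Otimes>i\<in>{1..Suc n}. s i) \<otimes> c"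
  proof -
    have "(\<Otimes>i\<in>{1..Suc (Suc n)}. ?r i) = (\<Otimes>i\<in>{1..Suc n}. ?r i) \<otimes> l"
      using finprod_Suc_atLeastAtMost[OF rc] by simp
    also have "(\<Otimes>i\<in>{1..Suc n}. ?r i) = (\<Otimes>i\<in>{1..Suc n}. r i)"
      using r squarefree_carrier by (intro finprod_cong') auto
    also have "\<dots> \<otimes> l = (\<Otimes>i\<in>{1..n}. s i) \<otimes> (c \<otimes> s (Suc n))"
      using prod eq carr by (simp add: m_assoc)
    also have "\<dots> = (\<Otimes>i\<in>{1..Suc n}. s i) \<otimes> c"
      using finprod_Suc_atLeastAtMost[OF sc] carr by (simp add: m_ac)
    finally show ?thesis .
  qed
  moreover have "?r i divides x"
    if x: "x \<in> carrier G" "c divides x" "\<forall>i\<in>{1..Suc n}. s i divides x"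
      and i: "i \<in> {1..Suc (Suc n)}" for x i
  proof -
    have "l divides x" using lcm x by auto
    moreover have "?r i divides l" using i rl carr by (cases "i = Suc (Suc n)") auto
    moreover have "?r i \<in> carrier G" using rc i by blast
    ultimately show ?thesis by (meson divides_trans)
  qed
  ultimately show ?case using r' by (intro bexI[of _ ?r]) blast+
qed

text \<open>The square-free factors are inserted one after the other into an initially empty divisor
  chain.\<close>

lemma cond_i_imp_cond_ii:
  assumes "cond_i G"
  shows "cond_ii G"
  unfolding cond_ii_def
proof
  fix a assume "a \<in> carrier G"
  then obtain n s where n: "n \<ge> 1" and s: "s \<in> {1..n::nat} \<rightarrow> squarefree_elements G"
    and a: "a = (\<Otimes>i\<in>{1..n}. s i)"
    using assms unfolding cond_i_def by blast
  have "\<exists>r\<in>{1..n} \<rightarrow> squarefree_elements G. (\<forall>i\<in>{1..<n}. r i divides r (i + 1)) \<and>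
      (\<Otimes>i\<in>{1..n}. s i) = (\<Otimes>i\<in>{1..n}. r i)"
    using s
  proof (induction n)
    case 0
    then show ?case by auto
  next
    case (Suc n)
    then obtain r where r: "r \<in> {1..n} \<rightarrow> squarefree_elements G"
        "\<forall>i\<in>{1..<n}. r i divides r (i + 1)" "(\<Otimes>i\<in>{1..n}. s i) = (\<Otimes>i\<in>{1..n}. r i)"
      by (auto simp: Pi_iff)
    have c: "s (Suc n) \<in> squarefree_elements G" using Suc.prems by auto
    have "(\<Otimes>i\<in>{1..Suc n}. s i) = (\<Otimes>i\<in>{1..n}. s i) \<otimes> s (Suc n)"
      using Suc.prems squarefree_carrier by (intro finprod_Suc_atLeastAtMost) auto
    then show ?case
      using divides_chain_insert[OF c r(1,2)] r(3) by metis
  qed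
  then show "\<exists>n::nat\<ge>1. \<exists>s\<in>{1..n} \<rightarrow> squarefree_elements G.
      (\<forall>i\<in>{1..<n}. s i divides s (i + 1)) \<and> a = (\<Otimes>i\<in>{1..n}. s i)"
    using n a by blast
qed

end

theorem proposition3p4:
  fixes H :: "('a, 'b) monoid_scheme"
  assumes "comm_monoid_cancel H"
  shows "((ACCP H \<longrightarrow> atomic H) \<and> (atomic H \<longrightarrow> cond_i H) \<and>
          (ACCP H \<longrightarrow> cond_iv H) \<and>
          (cond_iii H \<longrightarrow> cond_i H) \<and>
          (cond_iv H \<longrightarrow> cond_i H) \<and>
          (cond_ii H \<longrightarrow> cond_iii H) \<and>
          (cond_ii H \<longrightarrow> cond_v H) \<and>
          (cond_iv H \<longrightarrow> cond_vi H)) \<and>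
         (decomposition_monoid H \<longrightarrow>
            (cond_ii H \<longleftrightarrow> cond_iii H) \<and> (cond_iii H \<longrightarrow> cond_iv H)) \<and>
         (gcd_condition_monoid H \<longrightarrow>
            (cond_ii H \<longleftrightarrow> cond_iii H) \<and> (cond_iii H \<longleftrightarrow> cond_iv H))"
proof -
  interpret comm_monoid_cancel H by fact
  have decomp: "(cond_ii H \<longleftrightarrow> cond_iii H) \<and> (cond_iii H \<longrightarrow> cond_iv H)"
    if "decomposition_monoid H"
    using decomposition_monoid.cond_iii_imp_cond_ii[OF that]
      decomposition_monoid.cond_iii_imp_cond_iv[OF that] cond_ii_imp_cond_iii by blast
  \<comment> \<open>The remaining implication from (iv) to (iii) passes through (i) and
    (ii).\<close>
  have gcd: "(cond_ii H \<longleftrightarrow> cond_iii H) \<and> (cond_iii H \<longleftrightarrow> cond_iv H)"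
    if "gcd_condition_monoid H"
    using decomp[OF gcd_condition_monoid.decomposition_monoid[OF that]]
      gcd_condition_monoid.cond_i_imp_cond_ii[OF that] cond_iv_imp_cond_i by blast
  show ?thesis
    using ACCP_imp_divisor_chain_condition divisor_chain_condition_monoid.atomic
      divisor_chain_condition_monoid.cond_iv atomic_imp_cond_i cond_iii_imp_cond_i
      cond_iv_imp_cond_i cond_ii_imp_cond_iii cond_ii_imp_cond_v cond_iv_imp_cond_vi decomp gcd
    by blast
qed

end
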